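(* Let $D\subset\mathbb{R}^2$ be a connected and simply connected domain with non-empty interior, bounded by a smooth closed curve $\gamma$. Let $H$ be a smooth real-valued function defined on a neighborhood of $D$ which is constant on $\gamma$. Assume that the system $$H_{xx}(x,y)=H_{yy}(x,y),\qquad H_{xy}(x,y)=0$$ has only isolated solutions in $D$, none of which lie on $\gamma$. Let $\gamma(t)$ be an arc length parametrization of $\gamma$, oriented as the boundary of $D$, let $k(t)$ be its curvature and $n(t)$ the inward unit normal, and write $H(t,s):=H(\gamma(t)+s\,n(t))$ for $|s|$ small. Suppose that one of the following holds: (i) $H_{ss}(t,0)+k(t)H_s(t,0)\neq 0$ for all $t$; (ii) the normal derivative of $H$ vanishes identically along $\gamma$. Then the system above has two solutions in the interior of $D$, counted with multiplicities.
   Context: The solutions of the system are exactly the zeros of the vector field $V=(H_{yy}-H_{xx})\,\partial_x-2H_{xy}\,\partial_y$ (they are the conformal points of the Hamiltonian vector field $H_y\partial_x-H_x\partial_y$, i.e. points where the Hessian of $H$ is a scalar matrix). "Counted with multiplicities" means that the multiplicity of a solution is the index of the corresponding isolated zero of $V$; the claim is that the sum of these indices over the interior of $D$ equals $2$. *)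

theory Defs
  imports "HOL-Analysis.Analysis" "HOL-Complex_Analysis.Complex_Analysis"
begin

text \<open>C^k and C^infinity on an open set, via directional (Frechet) derivatives.\<close>
fun Ck_on :: "nat \<Rightarrow> 'a::real_normed_vector set \<Rightarrow> ('a \<Rightarrow> 'b::real_normed_vector) \<Rightarrow> bool" where
  "Ck_on 0 S f = continuous_on S f"
| "Ck_on (Suc k) S f = (f differentiable_on S \<and>
      (\<forall>v. Ck_on k S (\<lambda>x. frechet_derivative f (at x) v)))"

definition smooth_on :: "'a::real_normed_vector set \<Rightarrow> ('a \<Rightarrow> 'b::real_normed_vector) \<Rightarrow> bool" where
  "smooth_on S f \<longleftrightarrow> (\<forall>k. Ck_on k S f)"

text \<open>We identify R^2 with the complex plane: x = Re, y = Im.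
  Second partial derivatives of H.\<close>
definition d2 :: "(complex \<Rightarrow> real) \<Rightarrow> complex \<Rightarrow> complex \<Rightarrow> complex \<Rightarrow> real" where
  "d2 H z v w = frechet_derivative (\<lambda>u. frechet_derivative H (at u) v) (at z) w"

definition Hxx :: "(complex \<Rightarrow> real) \<Rightarrow> complex \<Rightarrow> real" where "Hxx H z = d2 H z 1 1"
definition Hyy :: "(complex \<Rightarrow> real) \<Rightarrow> complex \<Rightarrow> real" where "Hyy H z = d2 H z \<i> \<i>"
definition Hxy :: "(complex \<Rightarrow> real) \<Rightarrow> complex \<Rightarrow> real" where "Hxy H z = d2 H z 1 \<i>"

definition conf_field :: "(complex \<Rightarrow> real) \<Rightarrow> complex \<Rightarrow> complex" where
  "conf_field H z = Complex (Hyy H z - Hxx H z) (- 2 * Hxy H z)"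

text \<open>Index of a (isolated) zero p of a planar vector field V: winding number around 0 of
  V restricted to small circles about p (eventually constant as the radius tends to 0).\<close>
definition zero_index :: "(complex \<Rightarrow> complex) \<Rightarrow> complex \<Rightarrow> complex" where
  "zero_index V p = Lim (at_right 0) (\<lambda>r. winding_number (V \<circ> circlepath p r) 0)"

definition dcurve :: "(real \<Rightarrow> complex) \<Rightarrow> real \<Rightarrow> complex" where
  "dcurve g t = vector_derivative g (at t)"

text \<open>Inward unit normal for a positively (counterclockwise) oriented arc-length curve.\<close>
definition inward_normal :: "(real \<Rightarrow> complex) \<Rightarrow> real \<Rightarrow> complex" where
  "inward_normal g t = \<i> * dcurve g t"

text \<open>Signed curvature: g'' = k * n.\<close>
definition curvature :: "(real \<Rightarrow> complex) \<Rightarrow> real \<Rightarrow> real" where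
  "curvature g t = Im (cnj (dcurve g t) * dcurve (dcurve g) t)"

definition Hts :: "(complex \<Rightarrow> real) \<Rightarrow> (real \<Rightarrow> complex) \<Rightarrow> real \<Rightarrow> real \<Rightarrow> real" where
  "Hts H g t s = H (g t + of_real s * inward_normal g t)"

definition H_s :: "(complex \<Rightarrow> real) \<Rightarrow> (real \<Rightarrow> complex) \<Rightarrow> real \<Rightarrow> real \<Rightarrow> real" where
  "H_s H g t s = deriv (Hts H g t) s"

definition H_ss :: "(complex \<Rightarrow> real) \<Rightarrow> (real \<Rightarrow> complex) \<Rightarrow> real \<Rightarrow> real \<Rightarrow> real" where
  "H_ss H g t s = deriv (H_s H g t) s"

end

theory Submission
  imports Defs
begin

text \<open>Let \<open>T\<close> be the unit tangent of the boundary curve. In the moving frame \<open>T, n = \<i> T\<close> the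
  vector field is \<open>conf_field H = T\<^sup>2 q\<close>, where \<open>Re q = H\<^sub>s\<^sub>s + k H\<^sub>s\<close> because \<open>H\<close> is constant on the
  curve. Under either boundary condition \<open>Re q\<close> vanishes nowhere, so \<open>q\<close> has winding number 0 and
  the field winds twice as often as \<open>T\<close>, hence twice by Hopf's Umlaufsatz. This boundary winding
  number is the sum of the indices: after division by \<open>\<Prod>\<^sub>p (z - p)\<^bsup>m p\<^esup>\<close>, with \<open>m p\<close> the index of the
  zero \<open>p\<close>, the field can be modified near the zeros to a nowhere vanishing one, which has a
  continuous logarithm on \<open>D\<close> since \<open>D\<close> is compact with connected complement.\<close>

section \<open>Indices of zeros and winding numbers\<close>

lemma winding_number_log_increment:
  assumes q: "continuous_on {0..1} q" and p: "\<And>t. t \<in> {0..1} \<Longrightarrow> p t = exp (q t)"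
  shows "winding_number p 0 = (q 1 - q 0) / (2 * of_real pi * \<i>)"
proof -
  have "winding_number p 0 = winding_number (exp \<circ> q) 0"
    by (rule winding_number_cong) (simp add: p)
  also have "\<dots> = (q 1 - q 0) / (2 * of_real pi * \<i>)"
    using winding_number_compose_exp [of q] q by (simp add: path_def pathfinish_def pathstart_def)
  finally show ?thesis .
qed

lemma path_log_obtain:
  assumes "path p" "0 \<notin> path_image p"
  obtains q where "continuous_on {0..1} q" "\<And>t. t \<in> {0..1} \<Longrightarrow> p t = exp (q t)"
    "winding_number p 0 = (q 1 - q 0) / (2 * of_real pi * \<i>)"
proof -
  obtain q where q: "path q" "\<And>t. t \<in> {0..1} \<Longrightarrow> p t = 0 + exp (q t)"
    using winding_number_as_continuous_log [OF assms] by blast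
  show ?thesis
  proof
    show "continuous_on {0..1} q" using q(1) by (simp add: path_def)
    show "p t = exp (q t)" if "t \<in> {0..1}" for t using q(2) [OF that] by simp
    then show "winding_number p 0 = (q 1 - q 0) / (2 * of_real pi * \<i>)"
      using q(1) by (intro winding_number_log_increment) (auto simp: path_def)
  qed
qed

text \<open>Continuous logarithms of the two factors add up, whether or not the paths are
  closed.\<close>

lemma winding_number_mult:
  assumes "path p" "0 \<notin> path_image p" "path q" "0 \<notin> path_image q"
  shows "winding_number (\<lambda>t. p t * q t) 0 = winding_number p 0 + winding_number q 0"
proof -
  obtain u where u: "continuous_on {0..1} u" "\<And>t. t \<in> {0..1} \<Longrightarrow> p t = exp (u t)"
    "winding_number p 0 = (u 1 - u 0) / (2 * of_real pi * \<i>)"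
    using path_log_obtain [OF assms(1,2)] by blast
  obtain v where v: "continuous_on {0..1} v" "\<And>t. t \<in> {0..1} \<Longrightarrow> q t = exp (v t)"
    "winding_number q 0 = (v 1 - v 0) / (2 * of_real pi * \<i>)"
    using path_log_obtain [OF assms(3,4)] by blast
  have "winding_number (\<lambda>t. p t * q t) 0 = ((u 1 + v 1) - (u 0 + v 0)) / (2 * of_real pi * \<i>)"
    using u v by (intro winding_number_log_increment) (auto simp: exp_add intro!: continuous_intros)
  also have "\<dots> = winding_number p 0 + winding_number q 0"
    unfolding u(3) v(3) add_divide_distrib [symmetric] by (simp add: algebra_simps)
  finally show ?thesis .
qed

lemma winding_number_power_int:
  assumes "path p" "0 \<notin> path_image p"
  shows "winding_number (\<lambda>t. p t powi m) 0 = of_int m * winding_number p 0"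
proof -
  obtain u where u: "continuous_on {0..1} u" "\<And>t. t \<in> {0..1} \<Longrightarrow> p t = exp (u t)"
    "winding_number p 0 = (u 1 - u 0) / (2 * of_real pi * \<i>)"
    using path_log_obtain [OF assms(1,2)] by blast
  have "winding_number (\<lambda>t. p t powi m) 0 = (of_int m * u 1 - of_int m * u 0) / (2 * of_real pi * \<i>)"
    using u by (intro winding_number_log_increment)
      (auto simp: exp_power_int mult.commute intro!: continuous_intros)
  also have "\<dots> = of_int m * winding_number p 0"
    unfolding u(3) by (simp add: right_diff_distrib)
  finally show ?thesis .
qed

lemma winding_number_prod:
  assumes "finite Z" "\<And>a. a \<in> Z \<Longrightarrow> path (f a)" "\<And>a. a \<in> Z \<Longrightarrow> 0 \<notin> path_image (f a)"
  shows "winding_number (\<lambda>t. \<Prod>a\<in>Z. f a t) 0 = (\<Sum>a\<in>Z. winding_number (f a) 0)"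
  using assms
proof (induction Z)
  case empty
  have "winding_number (\<lambda>t. 1) 0 = (0 - 0) / (2 * of_real pi * \<i>)"
    by (intro winding_number_log_increment [where q = "\<lambda>t. 0"]) auto
  then show ?case by simp
next
  case (insert a Z)
  have "winding_number (\<lambda>t. f a t * (\<Prod>a\<in>Z. f a t)) 0
      = winding_number (f a) 0 + winding_number (\<lambda>t. \<Prod>a\<in>Z. f a t) 0"
    using insert.prems insert.hyps
    by (intro winding_number_mult)
       (force simp: path_def path_image_def intro!: continuous_intros)+
  then show ?case using insert by simp
qed

section \<open>Removing zeros of index 0\<close>

lemma circlepath_in_sphere: "0 \<le> r \<Longrightarrow> circlepath p r t \<in> sphere p r"
  by (simp add: circlepath dist_norm norm_mult)

text \<open>A loop in the punctured plane with winding number 0 is null-homotopic there, and a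
  null-homotopic map of the circle extends over the disc within the same target.\<close>

lemma extend_nonzero_to_cball:
  fixes F :: "complex \<Rightarrow> complex"
  assumes r: "r > 0" and F: "continuous_on (sphere p r) F" "0 \<notin> F ` sphere p r"
    and w: "winding_number (F \<circ> circlepath p r) 0 = 0"
  obtains E where "continuous_on (cball p r) E" "0 \<notin> E ` cball p r"
    "\<And>z. z \<in> sphere p r \<Longrightarrow> E z = F z"
proof -
  have path: "path (F \<circ> circlepath p r)"
    using F r by (intro path_continuous_image) auto
  have nz: "0 \<notin> path_image (F \<circ> circlepath p r)"
    using F r by (simp add: path_image_compose)
  obtain a where "homotopic_loops (- {0}) (F \<circ> circlepath p r) (\<lambda>t. a)"
    using w winding_number_homotopic_loops_null_eq [OF path nz] by blast
  \<comment> \<open>\<open>Arg2pi z / (2 * pi)\<close> is the loop parameter of the point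
    \<open>z\<close> of the unit circle; composing with it turns loops into circle maps.\<close>
  then have "homotopic_with_canon (\<lambda>h. True) (sphere 0 1) (- {0})
     ((F \<circ> circlepath p r) \<circ> (\<lambda>z. Arg2pi z / (2 * pi))) ((\<lambda>t. a) \<circ> (\<lambda>z. Arg2pi z / (2 * pi)))"
    by (rule homotopic_loops_imp_homotopic_circlemaps)
  then have "homotopic_with_canon (\<lambda>h. True) (sphere 0 1) (- {0}) (\<lambda>z. F (p + of_real r * z)) (\<lambda>z. a)"
  proof (rule homotopic_with_eq)
    fix z :: complex assume "z \<in> topspace (top_of_set (sphere 0 1))"
    then have "exp (\<i> * of_real (Arg2pi z)) = z"
      using Arg2pi_eq [of z] by simp
    then show "F (p + of_real r * z) = (F \<circ> circlepath p r \<circ> (\<lambda>z. Arg2pi z / (2 * pi))) z"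
      by (simp add: circlepath mult_ac)
  qed auto
  then obtain h where h: "continuous_on (cball 0 1) h" "h ` cball 0 1 \<subseteq> - {0}"
      "\<And>x. x \<in> sphere 0 1 \<Longrightarrow> h x = F (p + of_real r * x)"
    using nullhomotopic_from_sphere_extension [of 0 1 "- {0}" "\<lambda>z. F (p + of_real r * z)"] by blast
  show ?thesis
  proof
    have in01: "(z - p) / of_real r \<in> cball 0 1" if "z \<in> cball p r" for z
      using that r by (simp add: norm_divide dist_norm norm_minus_commute)
    show "continuous_on (cball p r) (\<lambda>z. h ((z - p) / of_real r))"
      using r in01 by (intro continuous_on_compose2 [OF h(1)]) (auto intro!: continuous_intros)
    show "0 \<notin> (\<lambda>z. h ((z - p) / of_real r)) ` cball p r"
      using h(2) in01 by (auto simp: image_subset_iff)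
    fix z assume z: "z \<in> sphere p r"
    then have "(z - p) / of_real r \<in> sphere 0 1"
      using r by (simp add: norm_divide dist_norm norm_minus_commute)
    then show "h ((z - p) / of_real r) = F z"
      using h(3) r by simp
  qed
qed

text \<open>Zeros are removed one at a time: in a small disc about \<open>p\<close> the field is
  replaced by a nonvanishing extension of its values on the bounding circle. \<open>K\<close> holds
  the points whose values must survive; in the application it is the image of the curve.\<close>

lemma nonvanishing_modification:
  fixes F :: "complex \<Rightarrow> complex"
  assumes "finite Z" "Z \<subseteq> interior S" "continuous_on (S - Z) F" "\<And>z. z \<in> S - Z \<Longrightarrow> F z \<noteq> 0"
    "\<And>p. p \<in> Z \<Longrightarrow> \<forall>\<^sub>F r in at_right 0. winding_number (F \<circ> circlepath p r) 0 = 0"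
    and K: "closed K" "K \<inter> Z = {}"
  shows "\<exists>E. continuous_on S E \<and> (\<forall>z\<in>S. E z \<noteq> 0) \<and> (\<forall>z\<in>S \<inter> K. E z = F z)"
  using assms
proof (induction Z arbitrary: F)
  case empty
  then show ?case by auto
next
  case (insert p Z F)
  \<comment> \<open>A disc about \<open>p\<close> in this set misses the other zeros and
    \<open>K\<close>, so a change inside the disc disturbs neither.\<close>
  have "open (interior S - (Z \<union> K))"
    using insert.hyps(1)
    by (intro open_Diff closed_Un open_interior finite_imp_closed insert.prems)
  moreover have "p \<in> interior S - (Z \<union> K)"
    using insert by auto
  ultimately obtain R where R: "R > 0" "ball p R \<subseteq> interior S - (Z \<union> K)"
    using open_contains_ball by blast
  have "\<forall>\<^sub>F r in at_right 0. winding_number (F \<circ> circlepath p r) 0 = 0 \<and> r \<in> {0<..<R}"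
    using insert.prems(4) [of p] R by (intro eventually_conj eventually_at_right_real) blast+
  then have "\<exists>r. winding_number (F \<circ> circlepath p r) 0 = 0 \<and> r \<in> {0<..<R}"
    by (rule eventually_happens' [OF trivial_limit_at_right_real])
  then obtain r where r: "winding_number (F \<circ> circlepath p r) 0 = 0" "r > 0" "r < R"
    by auto
  have "cball p r \<subseteq> ball p R"
    using r by auto
  then have sub: "cball p r \<subseteq> interior S - (Z \<union> K)"
    using R by blast
  have sph: "sphere p r \<subseteq> S - insert p Z"
  proof
    fix z assume z: "z \<in> sphere p r"
    then have "z \<in> cball p r" "z \<noteq> p" using r by auto
    then show "z \<in> S - insert p Z" using sub interior_subset by blast
  qed
  obtain B where B: "continuous_on (cball p r) B" "0 \<notin> B ` cball p r"
    "\<And>z. z \<in> sphere p r \<Longrightarrow> B z = F z"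
  proof (rule extend_nonzero_to_cball [of r p F])
    show "continuous_on (sphere p r) F"
      using insert.prems sph continuous_on_subset by blast
    show "0 \<notin> F ` sphere p r"
      using insert.prems(3) sph by (metis image_iff subsetD)
  qed (use r in auto)
  define F1 where "F1 z = (if z \<in> cball p r then B z else F z)" for z
  have contF: "continuous_on (S - insert p Z) F" using insert.prems by blast
  \<comment> \<open>The two relatively closed pieces meet only in the circle, where \<open>B\<close>
    and \<open>F\<close> agree.\<close>
  have cF1: "continuous_on (cball p r \<union> (S - Z - ball p r)) F1"
    unfolding F1_def
  proof (rule continuous_on_cases_local)
    let ?U = "cball p r \<union> (S - Z - ball p r)"
    show "closedin (top_of_set ?U) (cball p r)"
      by (metis Un_upper1 closed_cball closed_subset)
    have "S - Z - ball p r = ?U \<inter> - ball p r"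
      using sub interior_subset by blast
    then show "closedin (top_of_set ?U) (S - Z - ball p r)"
      by (metis closed_Compl closedin_closed_Int open_ball)
    show "continuous_on (S - Z - ball p r) F"
      using r by (intro continuous_on_subset [OF contF]) auto
    show "B x = F x" if "x \<in> cball p r \<and> x \<notin> cball p r \<or> x \<in> S - Z - ball p r \<and> x \<in> cball p r" for x
      using that by (intro B(3)) auto
  qed (use B in auto)
  have F1: "continuous_on (S - Z) F1"
    using cF1 by (rule continuous_on_subset) auto
  have nzF1: "F1 z \<noteq> 0" if z: "z \<in> S - Z" for z
  proof (cases "z \<in> cball p r")
    case True
    then have "B z \<noteq> 0" using B(2) by (metis image_eqI)
    then show ?thesis using True by (simp add: F1_def)
  next
    case False
    then have "z \<in> S - insert p Z" using z r by auto
    then show ?thesis using False insert.prems(3) by (simp add: F1_def)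
  qed
  \<comment> \<open>Small circles about a remaining zero miss \<open>cball p r\<close>, outside of
    which the field is unchanged; so the induction hypothesis applies to \<open>F1\<close>.\<close>
  have w1: "\<forall>\<^sub>F s in at_right 0. winding_number (F1 \<circ> circlepath q s) 0 = 0" if q: "q \<in> Z" for q
  proof -
    have "q \<notin> cball p r" using sub q by blast
    then obtain e where e: "e > 0" "ball q e \<subseteq> - cball p r"
      by (metis ComplI closed_Compl closed_cball open_Compl open_contains_ball)
    have "\<forall>\<^sub>F s in at_right 0. s \<in> {0<..<e}"
      using e by (intro eventually_at_right_real)
    moreover have "\<forall>\<^sub>F s in at_right 0. winding_number (F \<circ> circlepath q s) 0 = 0"
      using insert.prems(4) q by blast
    ultimately show ?thesis
    proof eventually_elim
      case (elim s)
      have "circlepath q s t \<in> - cball p r" for t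
        using e elim circlepath_in_sphere [of s q t] by (auto simp: subset_eq)
      then have "F1 \<circ> circlepath q s = F \<circ> circlepath q s"
        by (auto simp: F1_def fun_eq_iff)
      then show ?case using elim by simp
    qed
  qed
  obtain E where E: "continuous_on S E" "\<forall>z\<in>S. E z \<noteq> 0" "\<forall>z\<in>S \<inter> K. E z = F1 z"
    using insert.IH [of F1] insert.prems F1 nzF1 w1 by blast
  moreover have "F1 z = F z" if "z \<in> K" for z
    using that sub by (auto simp: F1_def)
  ultimately show ?case by auto
qed

section \<open>The index of a zero and an argument principle for continuous fields\<close>

lemma winding_number_circle_radius:
  fixes V :: "complex \<Rightarrow> complex"
  assumes V: "continuous_on (ball p R - {p}) V" "\<And>z. z \<in> ball p R - {p} \<Longrightarrow> V z \<noteq> 0"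
    and r: "0 < r" "r < R" and s: "0 < s" "s < R"
  shows "winding_number (V \<circ> circlepath p r) 0 = winding_number (V \<circ> circlepath p s) 0"
proof -
  \<comment> \<open>Points with the same parameter on the two concentric circles lie on one ray from
    \<open>p\<close>, so the segment joining them keeps its radii between \<open>r\<close> and
    \<open>s\<close> and misses \<open>p\<close>.\<close>
  have "homotopic_loops (ball p R - {p}) (circlepath p r) (circlepath p s)"
  proof (rule homotopic_loops_linear)
    fix t :: real
    show "closed_segment (circlepath p r t) (circlepath p s t) \<subseteq> ball p R - {p}"
    proof
      fix x assume "x \<in> closed_segment (circlepath p r t) (circlepath p s t)"
      then obtain u where u: "0 \<le> u" "u \<le> 1"
        "x = (1 - u) *\<^sub>R circlepath p r t + u *\<^sub>R circlepath p s t"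
        by (auto simp: in_segment)
      then have x: "x = p + of_real ((1 - u) * r + u * s) * exp (2 * of_real pi * \<i> * of_real t)"
        by (simp add: circlepath scaleR_conv_of_real algebra_simps)
      have "(1 - u) * r + u * s > 0"
        using u r s by (cases "u = 0") (auto intro: add_nonneg_pos)
      moreover have "(1 - u) * r + u * s < R"
        using u r s by (intro convex_bound_lt) auto
      moreover have "dist p x = \<bar>(1 - u) * r + u * s\<bar>"
        by (simp add: x dist_norm norm_mult del: of_real_add of_real_mult)
      ultimately show "x \<in> ball p R - {p}"
        by auto
    qed
  qed auto
  then have "homotopic_loops (- {0}) (V \<circ> circlepath p r) (V \<circ> circlepath p s)"
    using V by (intro homotopic_loops_continuous_image [where S = "ball p R - {p}"]) auto
  then show ?thesis
    by (rule winding_number_homotopic_loops)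
qed

text \<open>The limit in \<open>zero_index\<close> is that of an eventually constant function, so
  every radius below \<open>R\<close> already gives the index.\<close>

lemma zero_index_eq_winding_number:
  assumes V: "continuous_on (ball p R - {p}) V" "\<And>z. z \<in> ball p R - {p} \<Longrightarrow> V z \<noteq> 0"
    and r: "0 < r" "r < R"
  shows "zero_index V p = winding_number (V \<circ> circlepath p r) 0"
  unfolding zero_index_def
proof (rule tendsto_Lim)
  have "\<forall>\<^sub>F s in at_right 0. s \<in> {0<..<R}"
    using r by (intro eventually_at_right_real) auto
  then have "\<forall>\<^sub>F s in at_right 0. winding_number (V \<circ> circlepath p s) 0 = winding_number (V \<circ> circlepath p r) 0"
  proof eventually_elim
    case (elim s)
    then show ?case
      using r by (intro winding_number_circle_radius [OF V]) auto
  qed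
  then show "((\<lambda>s. winding_number (V \<circ> circlepath p s) 0) \<longlongrightarrow> winding_number (V \<circ> circlepath p r) 0) (at_right 0)"
    by (rule tendsto_eventually)
qed simp

text \<open>Dividing \<open>V\<close> by suitable powers of \<open>z - p\<close> makes all indices
  0. The quotient can then be changed near \<open>Z\<close> into a field with a continuous logarithm
  on \<open>S\<close>, so it does not wind along \<open>c\<close>, and only the divided factors
  contribute. The curve \<open>c\<close> need not be simple, hence the weights.\<close>

lemma winding_number_zero_index_sum:
  fixes V :: "complex \<Rightarrow> complex"
  assumes S: "compact S" "connected (- S)"
    and V: "continuous_on S V" "\<And>z. z \<in> S - Z \<Longrightarrow> V z \<noteq> 0"
    and Z: "finite Z" "Z \<subseteq> interior S"
    and c: "path c" "pathfinish c = pathstart c" "path_image c \<subseteq> S - Z"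
  shows "winding_number (V \<circ> c) 0 = (\<Sum>p\<in>Z. winding_number c p * zero_index V p)"
proof -
  have "\<exists>R>0. ball p R - {p} \<subseteq> S - Z" if p: "p \<in> Z" for p
  proof -
    have "open (interior S - (Z - {p}))"
      using Z by (intro open_Diff finite_imp_closed) auto
    moreover have "p \<in> interior S - (Z - {p})" using Z p by auto
    ultimately obtain R where "R > 0" "ball p R \<subseteq> interior S - (Z - {p})"
      using open_contains_ball by blast
    then show ?thesis using interior_subset by blast
  qed
  then obtain R where R: "\<And>p. p \<in> Z \<Longrightarrow> R p > 0" "\<And>p. p \<in> Z \<Longrightarrow> ball p (R p) - {p} \<subseteq> S - Z"
    by metis
  have circ: "circlepath p r t \<in> S - Z" if "p \<in> Z" "0 < r" "r < R p" for p r t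
  proof -
    have "circlepath p r t \<in> ball p (R p) - {p}"
      using that circlepath_in_sphere [of r p t] by auto
    then show ?thesis using R that by blast
  qed
  have idx: "zero_index V p = winding_number (V \<circ> circlepath p r) 0" if "p \<in> Z" "0 < r" "r < R p" for p r
  proof (rule zero_index_eq_winding_number)
    show "continuous_on (ball p (R p) - {p}) V"
      using V(1) R(2) [OF that(1)] by (rule continuous_on_subset [OF _ subset_trans]) auto
    show "V z \<noteq> 0" if "z \<in> ball p (R p) - {p}" for z
      using V(2) R(2) [OF \<open>p \<in> Z\<close>] that by blast
  qed (use that in auto)
  have pathV: "path (V \<circ> d)" "0 \<notin> path_image (V \<circ> d)" if "path d" "path_image d \<subseteq> S - Z" for d
  proof -
    show "path (V \<circ> d)"
      using that V by (intro path_continuous_image) (auto intro: continuous_on_subset)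
    show "0 \<notin> path_image (V \<circ> d)"
      using that V(2) by (force simp: path_image_compose)
  qed
  have circ_im: "path_image (circlepath p r) \<subseteq> S - Z" if "p \<in> Z" "0 < r" "r < R p" for p r
    using circ [OF that] by (auto simp: path_image_def simp del: path_image_circlepath)
  \<comment> \<open>The index is a complex number by definition; integrality lets it serve as the
    exponent in \<open>powi\<close>.\<close>
  have "zero_index V p \<in> \<int>" if p: "p \<in> Z" for p
  proof -
    have r: "0 < R p / 2" "R p / 2 < R p" using R(1) [OF p] by auto
    have "winding_number (V \<circ> circlepath p (R p / 2)) 0 \<in> \<int>"
    proof (rule integer_winding_number [OF pathV(1) _ pathV(2)])
      show "pathfinish (V \<circ> circlepath p (R p / 2)) = pathstart (V \<circ> circlepath p (R p / 2))"
        by (simp only: pathfinish_compose pathstart_compose pathfinish_circlepath pathstart_circlepath)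
    qed (use circ_im [OF p r] in \<open>simp_all only: path_circlepath\<close>)
    then show ?thesis using idx [OF p r] by simp
  qed
  then have "\<forall>p\<in>Z. \<exists>k. zero_index V p = of_int k"
    by (auto elim: Ints_cases)
  then obtain m where m: "\<And>p. p \<in> Z \<Longrightarrow> zero_index V p = of_int (m p)"
    using bchoice [of Z "\<lambda>p k. zero_index V p = of_int k"] by blast
  \<comment> \<open>At the points of \<open>Z\<close> the factors \<open>powi\<close> with base 0
    have only conventional values; \<open>F\<close> is used off \<open>Z\<close> alone.\<close>
  define F where "F z = V z * (\<Prod>p\<in>Z. (z - p) powi (- m p))" for z
  have windF: "winding_number (F \<circ> d) 0
      = winding_number (V \<circ> d) 0 - (\<Sum>p\<in>Z. of_int (m p) * winding_number d p)"
    if d: "path d" "path_image d \<subseteq> S - Z" for d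
  proof -
    have f: "path (\<lambda>t. d t - p)" "0 \<notin> path_image (\<lambda>t. d t - p)" if "p \<in> Z" for p
      using d that by (auto simp: path_def path_image_def intro!: continuous_intros)
    have f': "path (\<lambda>t. (d t - p) powi (- m p))" "0 \<notin> path_image (\<lambda>t. (d t - p) powi (- m p))"
      if "p \<in> Z" for p
      using f [OF that] by (auto simp: path_def path_image_def image_iff intro!: continuous_intros)
    have P: "path (\<lambda>t. \<Prod>p\<in>Z. (d t - p) powi (- m p))"
      using f'(1) unfolding path_def by (rule continuous_on_prod)
    have P0: "0 \<notin> path_image (\<lambda>t. \<Prod>p\<in>Z. (d t - p) powi (- m p))"
      using f' Z by (auto simp: path_image_def image_iff)
    have "F \<circ> d = (\<lambda>t. (V \<circ> d) t * (\<Prod>p\<in>Z. (d t - p) powi (- m p)))"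
      by (auto simp: F_def)
    then have "winding_number (F \<circ> d) 0 = winding_number (V \<circ> d) 0
        + winding_number (\<lambda>t. \<Prod>p\<in>Z. (d t - p) powi (- m p)) 0"
      using winding_number_mult [OF pathV [OF d] P P0] by simp
    also have "winding_number (\<lambda>t. \<Prod>p\<in>Z. (d t - p) powi (- m p)) 0
        = (\<Sum>p\<in>Z. winding_number (\<lambda>t. (d t - p) powi (- m p)) 0)"
      using Z f' by (intro winding_number_prod) auto
    also have "\<dots> = (\<Sum>p\<in>Z. - (of_int (m p) * winding_number d p))"
      using f winding_number_offset [of d] by (intro sum.cong) (auto simp: winding_number_power_int)
    finally show ?thesis by (simp add: sum_negf del: comp_apply o_apply)
  qed
  have "\<exists>E. continuous_on S E \<and> (\<forall>z\<in>S. E z \<noteq> 0) \<and> (\<forall>z\<in>S \<inter> path_image c. E z = F z)"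
  proof (rule nonvanishing_modification [OF Z])
    show "continuous_on (S - Z) F"
      unfolding F_def using V by (auto intro!: continuous_intros intro: continuous_on_subset)
    show "F z \<noteq> 0" if "z \<in> S - Z" for z
      using that V(2) Z by (auto simp: F_def)
    show "closed (path_image c)" using c by (simp add: closed_path_image)
    show "path_image c \<inter> Z = {}" using c by blast
    fix p assume p: "p \<in> Z"
    have "\<forall>\<^sub>F r in at_right 0. r \<in> {0<..<R p}"
      using R p by (intro eventually_at_right_real) auto
    then show "\<forall>\<^sub>F r in at_right 0. winding_number (F \<circ> circlepath p r) 0 = 0"
    proof eventually_elim
      case (elim r)
      then have r: "0 < r" "r < R p" by auto
      \<comment> \<open>The circle winds once around \<open>p\<close> and around no other zero, so
        only the factor of \<open>p\<close> contributes, and it cancels the index of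
        \<open>V\<close> at \<open>p\<close>.\<close>
      have "winding_number (circlepath p r) q = (if q = p then 1 else 0)" if "q \<in> Z" for q
      proof (cases "q = p")
        case False
        then have "q \<notin> ball p (R p)"
          using R(2) [OF p] that by blast
        then have "q \<notin> cball p r"
          using r by auto
        then show ?thesis
          using False r by (auto intro!: winding_number_zero_outside [where s = "cball p r"])
      qed (use r in \<open>simp add: winding_number_circlepath\<close>)
      then have "(\<Sum>q\<in>Z. of_int (m q) * winding_number (circlepath p r) q)
          = (\<Sum>q\<in>Z. if q = p then of_int (m p) else 0)"
        by (intro sum.cong) auto
      also have "\<dots> = of_int (m p)" using Z p by simp
      finally show ?case
        using windF [OF path_circlepath circ_im [OF p r]] idx [OF p r] m [OF p] by simp
    qed
  qed
  then obtain E where E: "continuous_on S E" "\<And>z. z \<in> S \<Longrightarrow> E z \<noteq> 0"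
      "\<And>z. z \<in> S \<inter> path_image c \<Longrightarrow> E z = F z"
    by blast
  \<comment> \<open>Here the connected complement enters: on such a compact set every nonvanishing
    continuous function has a continuous logarithm.\<close>
  have "Borsukian S" using S by (simp add: Borsukian_separation_compact)
  then obtain h where h: "continuous_on S h" "\<And>z. z \<in> S \<Longrightarrow> E z = exp (h z)"
    using E(1,2) unfolding Borsukian_continuous_logarithm by (metis ComplI Pi_I singletonD)
  have ct: "c t \<in> S \<inter> path_image c" if "t \<in> {0..1}" for t
  proof -
    have "c t \<in> path_image c" using that by (simp add: path_image_def)
    then show ?thesis using c(3) by blast
  qed
  have "winding_number (F \<circ> c) 0 = ((h \<circ> c) 1 - (h \<circ> c) 0) / (2 * of_real pi * \<i>)"
  proof (rule winding_number_log_increment)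
    show "continuous_on {0..1} (h \<circ> c)"
      using c ct h(1) by (intro continuous_on_compose) (auto simp: path_def intro: continuous_on_subset)
    show "(F \<circ> c) t = exp ((h \<circ> c) t)" if "t \<in> {0..1}" for t
      using ct [OF that] E(3) [of "c t"] h(2) [of "c t"] by auto
  qed
  also have "\<dots> = 0"
    using c by (simp add: pathfinish_def pathstart_def)
  finally have "winding_number (V \<circ> c) 0 = (\<Sum>p\<in>Z. of_int (m p) * winding_number c p)"
    using windF [of c] c by simp
  also have "\<dots> = (\<Sum>p\<in>Z. winding_number c p * zero_index V p)"
    using m by (intro sum.cong) auto
  finally show ?thesis .
qed

section \<open>The turning number of a simple closed curve\<close>

lemma log_increment_unique:
  fixes u v :: "real \<Rightarrow> complex"
  assumes "a \<le> b" "continuous_on {a..b} u" "continuous_on {a..b} v"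
    and eq: "\<And>t. t \<in> {a..b} \<Longrightarrow> exp (u t) = exp (v t)"
  shows "u b - u a = v b - v a"
proof -
  have "(\<lambda>t. u t - v t) constant_on {a..b}"
  proof (rule continuous_discrete_range_constant)
    fix x assume x: "x \<in> {a..b}"
    \<comment> \<open>Two logarithms of one number differ by an integer multiple of
      \<open>2 * pi * \<i>\<close>, so distinct values of \<open>u - v\<close> are at least
      \<open>2 * pi\<close> apart, and a continuous function with such a discrete range is
      constant.\<close>
    have "2 * pi \<le> norm ((u y - v y) - (u x - v x))"
      if y: "y \<in> {a..b} \<and> u y - v y \<noteq> u x - v x" for y
    proof -
      obtain m n where m: "u x = v x + of_int (2 * m) * (pi * \<i>)"
        and n: "u y = v y + of_int (2 * n) * (pi * \<i>)"
        using eq [OF x] eq [of y] y unfolding exp_eq by (auto simp: mult.assoc)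
      have "(u y - v y) - (u x - v x) = of_int (n - m) * (2 * pi * \<i>)"
        by (simp add: m n algebra_simps)
      moreover have "n \<noteq> m"
        using y m n by auto
      then have "1 \<le> \<bar>real_of_int (n - m)\<bar>"
        by linarith
      ultimately show ?thesis
        by (simp add: norm_mult del: of_int_diff)
    qed
    then show "\<exists>e>0. \<forall>y. y \<in> {a..b} \<and> u y - v y \<noteq> u x - v x \<longrightarrow> e \<le> norm ((u y - v y) - (u x - v x))"
      by (intro exI [of _ "2 * pi"]) auto
  qed (use assms in \<open>auto intro!: continuous_intros\<close>)
  then have "u b - v b = u a - v a"
    using \<open>a \<le> b\<close> unfolding constant_on_def by (metis atLeastAtMost_iff order_refl)
  then show ?thesis
    by (simp add: algebra_simps)
qed

text \<open>The closed right half plane without 0 avoids the branch cut of \<open>Ln\<close>, so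
  \<open>Ln\<close> supplies a second continuous logarithm to compare with \<open>u\<close>.\<close>

lemma log_increment_half_plane:
  fixes u :: "real \<Rightarrow> complex"
  assumes "a \<le> b" "continuous_on {a..b} u" and Re: "\<And>t. t \<in> {a..b} \<Longrightarrow> 0 \<le> Re (exp (u t))"
  shows "u b - u a = Ln (exp (u b)) - Ln (exp (u a))"
proof (rule log_increment_unique [where v = "\<lambda>t. Ln (exp (u t))"])
  have "exp (u t) \<notin> \<real>\<^sub>\<le>\<^sub>0" if "t \<in> {a..b}" for t
    using Re [OF that] by (metis complex_nonpos_Reals_iff complex_eqI exp_not_eq_zero order_antisym zero_complex.simps)
  then show "continuous_on {a..b} (\<lambda>t. Ln (exp (u t)))"
    using assms by (intro continuous_intros) auto
qed (use assms in auto)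

text \<open>The principal arguments at both ends lie between \<open>- pi / 2\<close> and
  \<open>pi / 2\<close>.\<close>

lemma log_increment_half_plane_le:
  fixes u :: "real \<Rightarrow> complex"
  assumes "a \<le> b" "continuous_on {a..b} u" "\<And>t. t \<in> {a..b} \<Longrightarrow> 0 \<le> Re (exp (u t))"
  shows "\<bar>Im (u b - u a)\<bar> \<le> pi"
proof -
  have "\<bar>Im (Ln (exp (u t)))\<bar> \<le> pi / 2" if "t \<in> {a..b}" for t
    using assms(3) [OF that] Re_Ln_pos_le [of "exp (u t)"] by simp
  from this [of a] this [of b] show ?thesis
    using log_increment_half_plane [OF assms] \<open>a \<le> b\<close> by simp
qed

text \<open>The integral extends the difference quotient of \<open>g\<close> continuously to
  \<open>h = 0\<close>, where it equals \<open>g' s\<close>; the form without division covers that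
  case too.\<close>

lemma has_integral_difference_quotient:
  fixes g g' :: "real \<Rightarrow> 'a::banach"
  assumes g: "\<And>t. (g has_vector_derivative g' t) (at t)" and g': "continuous_on UNIV g'"
  shows "h *\<^sub>R integral {0..1} (\<lambda>u. g' (s + u * h)) = g (s + h) - g s"
proof -
  have "((\<lambda>u. h *\<^sub>R g' (s + u * h)) has_integral (g (s + 1 * h) - g (s + 0 * h))) {0..1}"
  proof (rule fundamental_theorem_of_calculus)
    fix u :: real
    have "((\<lambda>u. s + u * h) has_vector_derivative h) (at u)"
      unfolding has_real_derivative_iff_has_vector_derivative [symmetric]
      by (auto intro!: derivative_eq_intros)
    then have "((\<lambda>u. g (s + u * h)) has_vector_derivative h *\<^sub>R g' (s + u * h)) (at u)"
      using vector_diff_chain_at [OF _ g] by (auto simp: o_def)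
    then show "((\<lambda>u. g (s + u * h)) has_vector_derivative h *\<^sub>R g' (s + u * h)) (at u within {0..1})"
      by (rule has_vector_derivative_at_within)
  qed simp
  from integral_unique [OF this] show ?thesis
    by simp
qed

section \<open>Periodic curves and Hopf's Umlaufsatz\<close>

lemma has_vector_derivative_periodic:
  fixes g :: "real \<Rightarrow> 'a::real_normed_vector"
  assumes g: "\<And>t. (g has_vector_derivative g' t) (at t)" and per: "\<And>t. g (t + L) = g t"
  shows "g' (t + L) = g' t"
proof -
  have "((\<lambda>t. t + L) has_vector_derivative 1) (at t)"
    unfolding has_real_derivative_iff_has_vector_derivative [symmetric]
    by (auto intro!: derivative_eq_intros)
  then have "((\<lambda>t. g (t + L)) has_vector_derivative g' (t + L)) (at t)"
    using vector_diff_chain_at [of "\<lambda>t. t + L" 1 t g, OF _ g] by (simp add: o_def)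
  then have "(g has_vector_derivative g' (t + L)) (at t)"
    by (simp add: per)
  then show ?thesis
    by (rule vector_derivative_unique_at [OF _ g])
qed

lemma periodic_in_range:
  fixes g :: "real \<Rightarrow> 'a"
  assumes "L > 0" "\<And>t. g (t + L) = g t"
  obtains s where "s \<in> {0..<L}" "g s = g t" "\<exists>k::int. t = s + of_int k * L"
proof -
  have per: "g (t + of_nat n * L) = g t" for n t
    by (induction n arbitrary: t) (use assms(2) in \<open>auto simp: algebra_simps\<close>, metis add.assoc assms(2))
  define k where "k = \<lfloor>t / L\<rfloor>"
  define s where "s = t - of_int k * L"
  have "of_int k \<le> t / L" "t / L < of_int k + 1"
    unfolding k_def by linarith+
  then have s: "s \<in> {0..<L}"
    using \<open>L > 0\<close> by (simp add: s_def field_simps)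
  have "g s = g t"
  proof (cases "k \<ge> 0")
    case True
    then have "t = s + of_nat (nat k) * L" by (simp add: s_def)
    then show ?thesis using per by metis
  next
    case False
    then have "s = t + of_nat (nat (- k)) * L" by (simp add: s_def)
    then show ?thesis using per by metis
  qed
  then show ?thesis
    using that [OF s] by (metis diff_add_cancel s_def)
qed

text \<open>Every base point \<open>s\<close> splits the turning of the tangent into two equal halves, each being the
  turning of the chord from \<open>g s\<close> as its end point runs once along the curve. With the base point
  farthest from \<open>z\<close> these chords stay in a half plane, so the turning number is at most 1 in absolute
  value; with the base point nearest to \<open>z\<close> they stay within a right angle of the
  radius vector \<open>g - z\<close>, so the turning number differs from 2 by at most 1.\<close>
lemma turning_number_simple_closed_curve:
  fixes g g' :: "real \<Rightarrow> complex"
  assumes L: "L > 0" and g: "\<And>t. (g has_vector_derivative g' t) (at t)"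
    and g': "continuous_on UNIV g'" "\<And>t. g' t \<noteq> 0"
    and per: "\<And>t. g (t + L) = g t" and inj: "inj_on g {0..<L}"
    and z: "z \<notin> range g" "winding_number (\<lambda>u. g (L * u)) z = 1"
  shows "winding_number (\<lambda>u. g' (L * u)) 0 = 1"
proof -
  define K where "K s h = integral {0..1} (\<lambda>u. g' (s + u * h))" for s h
  have contg: "continuous_on UNIV g"
    using g by (intro continuous_at_imp_continuous_on) (blast intro: has_vector_derivative_continuous)
  have contK: "continuous_on UNIV (\<lambda>x. K (fst x) (snd x))"
  proof -
    have "continuous_on (UNIV \<times> cbox 0 1) (\<lambda>(x, u). g' (fst x + u * snd x))"
      unfolding case_prod_unfold
      by (rule continuous_on_compose2 [OF g'(1)]) (auto intro!: continuous_intros)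
    then show ?thesis
      unfolding K_def cbox_interval [symmetric] by (rule integral_continuous_on_param)
  qed
  have K: "of_real h * K s h = g (s + h) - g s" for s h
    using has_integral_difference_quotient [OF g g'(1), of h s]
    by (simp add: K_def scaleR_conv_of_real)
  have K0: "K s 0 = g' s" for s
    by (simp add: K_def)
  have KL: "K s L = 0" for s
    using K [of L s] L per by simp
  have g'per: "g' (t + L) = g' t" for t
    by (rule has_vector_derivative_periodic [OF g per])
  have Kper: "K (s + L) h = K s h" for s h
    unfolding K_def using g'per by (metis (no_types, lifting) add.assoc add.commute)
  (* For 0 < h < L this is L (g (s + h) - g s) / (h (L - h)), extended continuously to h = 0 and h = L. *)
  define G where "G s h = K s h - K (s + h) (L - h)" for s h
  have G: "of_real (h * (L - h)) * G s h = of_real L * (g (s + h) - g s)" for s h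
  proof -
    have e: "of_real (L - h) * K (s + h) (L - h) = g s - g (s + h)"
      using K [of "L - h" "s + h"] per by simp
    have "of_real (h * (L - h)) * G s h
        = of_real (L - h) * (of_real h * K s h) - of_real h * (of_real (L - h) * K (s + h) (L - h))"
      unfolding G_def of_real_mult by (simp add: algebra_simps)
    then show ?thesis
      unfolding K [of h s] e by (simp add: algebra_simps)
  qed
  \<comment> \<open>For fixed \<open>s\<close> the chord direction thus runs from the tangent at
    \<open>h = 0\<close> to the opposite tangent at \<open>h = L\<close>.\<close>
  have G0: "G s 0 = g' s" and GL: "G s L = - g' s" for s
    by (simp_all add: G_def K0 KL g'per)
  have Gper: "G (s + L) h = G s h" for s h
    using Kper [of s h] Kper [of "s + h" "L - h"] by (simp add: G_def add_ac)
  \<comment> \<open>Starting the chord at its other end point reverses it; by periodicity the new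
    end point \<open>s + L\<close> stands for \<open>s\<close>.\<close>
  have Ganti: "G (s + h) (L - h) = - G s h" for s h
    using Kper by (simp add: G_def)
  \<comment> \<open>On the edges this is \<open>g' t \<noteq> 0\<close>; in between it is
    simplicity, since \<open>s\<close> and \<open>s + h\<close> with \<open>0 < h < L\<close> have
    different representatives in one period.\<close>
  have Gnz: "G s h \<noteq> 0" if h: "h \<in> {0..L}" for s h
  proof (cases "h = 0 \<or> h = L")
    case True
    then show ?thesis using G0 GL g'(2) by auto
  next
    case False
    then have h: "0 < h" "h < L" using h by auto
    obtain a where a: "a \<in> {0..<L}" "g a = g s" "\<exists>k::int. s = a + of_int k * L"
      using periodic_in_range [of L g s] L per by metis
    obtain b where b: "b \<in> {0..<L}" "g b = g (s + h)" "\<exists>k::int. s + h = b + of_int k * L"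
      using periodic_in_range [of L g "s + h"] L per by metis
    have "a \<noteq> b"
    proof
      assume "a = b"
      then obtain k :: int where k: "h = of_int k * L"
        using a(3) b(3) by (metis (no_types, lifting) add_diff_cancel_left' add_diff_cancel_left left_diff_distrib' of_int_diff)
      then have "0 < of_int k * L" "of_int k * L < 1 * L" using h by auto
      then have "0 < k" "k < 1"
        using L by (auto simp: zero_less_mult_iff)
      then show False by simp
    qed
    then have "g (s + h) \<noteq> g s"
      using inj a b by (metis inj_onD)
    then show ?thesis
      using G [of h s] L by auto
  qed
  have contG: "continuous_on UNIV (\<lambda>x. G (fst x) (snd x))"
    unfolding G_def
    by (intro continuous_intros contK continuous_on_compose2 [OF contK, of _ "\<lambda>x. (fst x + snd x, L - snd x)", simplified])
  \<comment> \<open>The strip is convex, so one logarithm of \<open>G\<close> serves for all base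
    points and all chords at once.\<close>
  obtain l where l: "continuous_on ((UNIV :: real set) \<times> {0..L}) l"
      "\<And>x. x \<in> (UNIV :: real set) \<times> {0..L} \<Longrightarrow> G (fst x) (snd x) = exp (l x)"
  proof (rule continuous_logarithm_on_contractible)
    show "contractible ((UNIV :: real set) \<times> {0..L})"
      by (intro convex_imp_contractible convex_Times) auto
    show "continuous_on ((UNIV :: real set) \<times> {0..L}) (\<lambda>x. G (fst x) (snd x))"
      using contG by (rule continuous_on_subset) simp
    show "G (fst x) (snd x) \<noteq> 0" if "x \<in> (UNIV :: real set) \<times> {0..L}" for x
      using that Gnz by (auto simp: mem_Times_iff)
  qed (rule that)
  have contl: "continuous_on S (\<lambda>t. l (p t, q t))"
    if "continuous_on S p" "continuous_on S q" "\<And>t. t \<in> S \<Longrightarrow> q t \<in> {0..L}" for p q and S :: "real set"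
    by (rule continuous_on_compose2 [OF l(1)]) (use that in \<open>auto intro!: continuous_intros\<close>)
  have expl: "exp (l (s, h)) = G s h" if "h \<in> {0..L}" for s h
    using l(2) [of "(s, h)"] that by simp
  define w where "w = winding_number (\<lambda>u. g' (L * u)) 0"
  have w: "l (L, 0) - l (0, 0) = 2 * of_real pi * \<i> * w"
  proof -
    have "w = (l (L * 1, 0) - l (L * 0, 0)) / (2 * of_real pi * \<i>)"
      unfolding w_def using L expl G0
      by (intro winding_number_log_increment) (auto intro!: contl continuous_intros)
    then show ?thesis by simp
  qed
  have "w \<in> \<int>"
    unfolding w_def
  proof (rule integer_winding_number)
    show "path (\<lambda>u. g' (L * u))"
      unfolding path_def by (rule continuous_on_compose2 [OF g'(1)]) (auto intro!: continuous_intros)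
    show "pathfinish (\<lambda>u. g' (L * u)) = pathstart (\<lambda>u. g' (L * u))"
      using g'per [of 0] by (simp add: pathfinish_def pathstart_def)
    show "0 \<notin> path_image (\<lambda>u. g' (L * u))"
      using g'(2) by (auto simp: path_image_def)
  qed
  then obtain m where m: "w = of_int m" by (auto elim: Ints_cases)
  \<comment> \<open>By periodicity the logarithm gains \<open>2 * pi * \<i> * m\<close> from
    \<open>(s, 0)\<close> to \<open>(s + L, 0)\<close>. Going through \<open>(s, L)\<close> splits
    this gain in two: along the points \<open>(s + h, L - h)\<close> the direction is
    \<open>- G s h\<close> by \<open>Ganti\<close>, so the second part equals the first.\<close>
  have half: "l (s, L) - l (s, 0) = of_real pi * \<i> * of_int m" if "s \<ge> 0" for s
  proof -
    have "l (s + L, 0) - l (0 + L, 0) = l (s, 0) - l (0, 0)"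
      using that L by (intro log_increment_unique contl continuous_intros) (auto simp: expl Gper)
    moreover have "l (s + L, L - L) - l (s + 0, L - 0)
        = (l (s, L) + of_real pi * \<i>) - (l (s, 0) + of_real pi * \<i>)"
      using L by (intro log_increment_unique contl continuous_intros) (auto simp: expl exp_add Ganti)
    ultimately have "2 * (l (s, L) - l (s, 0)) = 2 * (of_real pi * \<i> * of_int m)"
      using w m by (simp add: algebra_simps)
    then show ?thesis by (simp only: mult_cancel_left) simp
  qed
  (* exp (v h) is a reference direction from which the chord g (s + h) - g s deviates by at most pi/2. *)
  have quadrant: "\<bar>Im (l (s, L) - l (s, 0) - (v L - v 0))\<bar> \<le> pi"
    if v: "continuous_on {0..L} v"
      and Re: "\<And>h. 0 < h \<Longrightarrow> h < L \<Longrightarrow> 0 \<le> Re ((g (s + h) - g s) / exp (v h))" for s v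
  proof -
    let ?f = "\<lambda>h. Re (exp (l (s, h) - v h))"
    have cont: "continuous_on {0..L} (\<lambda>h. l (s, h) - v h)"
      using v by (intro contl continuous_intros) auto
    have "0 \<le> ?f h" if h: "h \<in> {0<..<L}" for h
    proof -
      have "exp (l (s, h) - v h) = G s h / exp (v h)"
        using h by (simp add: exp_diff expl)
      also have "G s h = of_real (L / (h * (L - h))) * (g (s + h) - g s)"
        using G [of h s] h by (simp add: field_simps)
      finally have "exp (l (s, h) - v h) = of_real (L / (h * (L - h))) * ((g (s + h) - g s) / exp (v h))"
        by simp
      then have "?f h = L / (h * (L - h)) * Re ((g (s + h) - g s) / exp (v h))"
        by (simp only: times_complex.sel Re_complex_of_real Im_complex_of_real mult_zero_left diff_zero)
      then show ?thesis
        using Re h L by simp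
    qed
    note pos = this
    have clos: "closure {0<..<L} = {0..L}"
      using L by simp
    have "continuous_on {0..L} ?f"
      by (intro continuous_on_Re continuous_on_exp cont)
    then have "0 \<le> ?f h" if "h \<in> {0..L}" for h
      using continuous_ge_on_closure [of "{0<..<L}" ?f h 0] that pos unfolding clos by blast
    then have "\<bar>Im ((l (s, L) - v L) - (l (s, 0) - v 0))\<bar> \<le> pi"
      by (rule log_increment_half_plane_le [OF less_imp_le [OF L] cont])
    then show ?thesis
      by (simp add: algebra_simps)
  qed
  have gz: "g t - z \<noteq> 0" for t
    using z(1) by auto
  have cdist: "continuous_on {0..L} (\<lambda>t. norm (g t - z))"
    using contg by (intro continuous_intros) (auto intro: continuous_on_subset)
  have ext: "\<exists>s\<in>{0..L}. g s = g t" for t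
    using periodic_in_range [of L g t] L per by (metis atLeastAtMost_iff atLeastLessThan_iff less_imp_le)
  obtain s where s: "s \<in> {0..L}" "\<And>t. t \<in> {0..L} \<Longrightarrow> norm (g t - z) \<le> norm (g s - z)"
    using continuous_attains_sup [OF _ _ cdist] L by fastforce
  obtain r where r: "r \<in> {0..L}" "\<And>t. t \<in> {0..L} \<Longrightarrow> norm (g r - z) \<le> norm (g t - z)"
    using continuous_attains_inf [OF _ _ cdist] L by fastforce
  have s_max: "norm (g t - z) \<le> norm (g s - z)" and r_min: "norm (g r - z) \<le> norm (g t - z)" for t
    using s(2) r(2) ext [of t] by metis+
  \<comment> \<open>The curve lies in the disc about \<open>z\<close> through its farthest point
    \<open>g s\<close>, hence on one side of the tangent line of that disc at \<open>g s\<close>;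
    the reference direction is the constant \<open>z - g s\<close>.\<close>
  have "\<bar>Im (l (s, L) - l (s, 0) - (Ln (z - g s) - Ln (z - g s)))\<bar> \<le> pi"
  proof (rule quadrant)
    fix h
    have "Re ((g (s + h) - z) / (g s - z)) \<le> norm ((g (s + h) - z) / (g s - z))"
      by (rule complex_Re_le_cmod)
    also have "\<dots> \<le> 1"
      using s_max [of "s + h"] gz [of s] by (simp add: norm_divide)
    finally have "0 \<le> Re (1 - (g (s + h) - z) / (g s - z))"
      by simp
    also have "1 - (g (s + h) - z) / (g s - z) = (g (s + h) - g s) / (z - g s)"
      using gz [of s] by (simp add: field_simps)
    finally show "0 \<le> Re ((g (s + h) - g s) / exp (Ln (z - g s)))"
      using gz [of s] by simp
  qed auto
  then have "\<bar>pi * of_int m\<bar> \<le> pi * 1"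
    using s(1) by (subst (asm) half) auto
  then have m1: "\<bar>m\<bar> \<le> 1"
    by (simp add: abs_mult)
  obtain v where v: "continuous_on UNIV v" "\<And>t. g t - z = exp (v t)"
  proof (rule continuous_logarithm_on_contractible)
    show "continuous_on UNIV (\<lambda>t. g t - z)"
      using contg by (intro continuous_intros)
    show "g t - z \<noteq> 0" for t
      by (rule gz)
  qed (auto intro: that)
  have contv: "continuous_on S (\<lambda>t. v (p t))" if "continuous_on S p" for p and S :: "real set"
    by (rule continuous_on_compose2 [OF v(1) that]) auto
  have vL: "v L - v 0 = 2 * of_real pi * \<i>"
  proof -
    have "winding_number (\<lambda>u. g (L * u) - z) 0 = (v (L * 1) - v (L * 0)) / (2 * of_real pi * \<i>)"
      using v(2) by (intro winding_number_log_increment contv continuous_intros)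
    moreover have "winding_number (\<lambda>u. g (L * u) - z) 0 = 1"
      using z(2) winding_number_offset [of "\<lambda>u. g (L * u)" z] by simp
    ultimately show ?thesis
      by (simp add: field_simps)
  qed
  have "v (r + L) - v (0 + L) = v r - v 0"
    using r(1) L per by (intro log_increment_unique contv continuous_intros) (auto simp flip: v(2))
  then have "v (r + L) - v (r + 0) = 2 * of_real pi * \<i>"
    using vL by (simp add: algebra_simps)
  \<comment> \<open>The moving reference direction is the radius vector to the end point of the
    chord. As \<open>g r\<close> is nearest to \<open>z\<close>, the quotient of the two radius
    vectors has norm at most 1, so subtracting it from 1 leaves a nonnegative real part. The
    reference itself turns by \<open>2 * pi\<close>.\<close>
  moreover have "\<bar>Im (l (r, L) - l (r, 0) - (v (r + L) - v (r + 0)))\<bar> \<le> pi"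
  proof (rule quadrant)
    fix h
    have "Re ((g r - z) / (g (r + h) - z)) \<le> norm ((g r - z) / (g (r + h) - z))"
      by (rule complex_Re_le_cmod)
    also have "\<dots> \<le> 1"
      using r_min [of "r + h"] gz [of "r + h"] by (simp add: norm_divide)
    finally have "0 \<le> Re (1 - (g r - z) / (g (r + h) - z))"
      by simp
    also have "1 - (g r - z) / (g (r + h) - z) = (g (r + h) - g r) / (g (r + h) - z)"
      using gz [of "r + h"] by (simp add: field_simps)
    finally show "0 \<le> Re ((g (r + h) - g r) / exp (v (r + h)))"
      by (simp only: v(2))
  qed (intro contv continuous_intros)
  ultimately have "\<bar>pi * of_int m - 2 * pi\<bar> \<le> pi"
    using r(1) half [of r] by (simp only: atLeastAtMost_iff) simp
  then have "\<bar>pi * (of_int m - 2)\<bar> \<le> pi * 1"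
    by (simp add: algebra_simps)
  then have "\<bar>m - 2\<bar> \<le> 1"
    by (simp add: abs_mult)
  \<comment> \<open>The farthest point confines \<open>m\<close> to \<open>-1..1\<close>, the
    nearest one to \<open>1..3\<close>.\<close>
  then have "m = 1"
    using m1 by linarith
  then show ?thesis
    using m by (simp add: w_def)
qed

section \<open>The Hessian along a level curve\<close>

lemma has_real_derivative_along_curve:
  fixes f :: "'a::real_normed_vector \<Rightarrow> real"
  assumes "(c has_vector_derivative c') (at t)" "f differentiable (at (c t))"
  shows "((\<lambda>s. f (c s)) has_real_derivative frechet_derivative f (at (c t)) c') (at t)"
proof -
  have "(f has_derivative frechet_derivative f (at (c t))) (at (c t) within range c)"
    using assms(2) by (simp add: frechet_derivative_works has_derivative_at_withinI)
  from vector_derivative_diff_chain_within [OF assms(1) this] show ?thesis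
    by (simp add: has_real_derivative_iff_has_vector_derivative o_def)
qed

lemma linear_complex_basis:
  fixes f :: "complex \<Rightarrow> real"
  assumes "linear f"
  shows "f v = Re v * f 1 + Im v * f \<i>"
proof -
  have "v = Re v *\<^sub>R 1 + Im v *\<^sub>R \<i>"
    by (simp add: complex_eq_iff)
  then have "f v = f (Re v *\<^sub>R 1 + Im v *\<^sub>R \<i>)"
    by simp
  then show ?thesis
    by (simp only: linear_add [OF assms] linear_scale [OF assms] real_scaleR_def)
qed

lemma has_vector_derivative_translate:
  "((\<lambda>s. p + of_real s * d) has_vector_derivative d) (at s)" for p d :: complex
proof -
  have "((\<lambda>s. p + s *\<^sub>R d) has_vector_derivative d) (at s)"
    by (auto intro!: derivative_eq_intros)
  then show ?thesis by (simp add: scaleR_conv_of_real)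
qed

lemma smooth_on_differentiable:
  assumes "smooth_on U H" "open U" "z \<in> U"
  shows "H differentiable (at z)"
proof -
  have "Ck_on (Suc 0) U H" using assms by (auto simp: smooth_on_def)
  then show ?thesis
    using assms at_within_open [of z U] by (auto simp: differentiable_on_def)
qed

lemma smooth_on_frechet_derivative:
  assumes "smooth_on U H"
  shows "smooth_on U (\<lambda>u. frechet_derivative H (at u) v)"
  using assms unfolding smooth_on_def by (metis Ck_on.simps(2))

lemma smooth_on_imp_continuous_on: "smooth_on U H \<Longrightarrow> continuous_on U H"
  unfolding smooth_on_def by (metis Ck_on.simps(1))

lemma continuous_on_d2: "smooth_on U H \<Longrightarrow> continuous_on U (\<lambda>z. d2 H z v w)"
  unfolding d2_def by (intro smooth_on_imp_continuous_on smooth_on_frechet_derivative)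

lemma continuous_on_conf_field: "smooth_on U H \<Longrightarrow> continuous_on U (conf_field H)"
  unfolding conf_field_def Hxx_def Hyy_def Hxy_def
  by (intro continuous_intros continuous_on_d2)

text \<open>The mean value theorem is applied first in direction \<open>v\<close> to a difference of
  values of \<open>H\<close>, then in direction \<open>w\<close> to the derivative so obtained. The
  second difference on the left is symmetric in \<open>v\<close> and \<open>w\<close>, which is what
  \<open>d2_commute\<close> exploits.\<close>

lemma d2_mean_value:
  assumes U: "open U" and H: "smooth_on U H" and h: "h > 0"
    and vw: "norm v = 1" "norm w = 1" and sub: "ball z (3 * h) \<subseteq> U"
  shows "\<exists>p\<in>ball z (3 * h). H (z + of_real h * v + of_real h * w) - H (z + of_real h * v)
      - (H (z + of_real h * w) - H z) = h * (h * d2 H p v w)"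
proof -
  \<comment> \<open>The parallelogram has diameter at most \<open>2 * h\<close> from
    \<open>z\<close>, and \<open>3 * h\<close> makes the bound strict.\<close>
  have inU: "z + of_real s * v + of_real t * w \<in> ball z (3 * h)"
    if "0 \<le> s" "s \<le> h" "0 \<le> t" "t \<le> h" for s t
  proof -
    have "norm (of_real s * v + of_real t * w) \<le> norm (of_real s * v) + norm (of_real t * w)"
      by (rule norm_triangle_ineq)
    also have "\<dots> < 3 * h"
      using that h vw by (simp add: norm_mult)
    finally show ?thesis
      by (simp add: dist_norm norm_minus_commute add.assoc add.commute)
  qed
  have dH: "((\<lambda>s. H (q + of_real s * v)) has_real_derivative
      frechet_derivative H (at (q + of_real s * v)) v) (at s)" if "q + of_real s * v \<in> U" for q s
    by (rule has_real_derivative_along_curve [OF has_vector_derivative_translate smooth_on_differentiable [OF H U that]])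
  have "\<exists>s. 0 < s \<and> s < h \<and>
     (H ((z + of_real h * w) + of_real h * v) - H (z + of_real h * v)) -
     (H ((z + of_real h * w) + of_real 0 * v) - H (z + of_real 0 * v))
    = (h - 0) * (frechet_derivative H (at ((z + of_real h * w) + of_real s * v)) v
       - frechet_derivative H (at (z + of_real s * v)) v)"
  proof (rule MVT2)
    fix s assume s: "0 \<le> s" "s \<le> h"
    show "((\<lambda>s. H ((z + of_real h * w) + of_real s * v) - H (z + of_real s * v)) has_real_derivative
       frechet_derivative H (at ((z + of_real h * w) + of_real s * v)) v
       - frechet_derivative H (at (z + of_real s * v)) v) (at s)"
      using inU [OF s, of h] inU [OF s, of 0] h sub
      by (intro DERIV_diff dH) (auto simp: add_ac)
  qed (use h in auto)
  then obtain s where s: "0 < s" "s < h" and eq1: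
     "H (z + of_real h * v + of_real h * w) - H (z + of_real h * v) - (H (z + of_real h * w) - H z)
    = h * (frechet_derivative H (at ((z + of_real s * v) + of_real h * w)) v
       - frechet_derivative H (at ((z + of_real s * v) + of_real 0 * w)) v)"
    by (auto simp: add_ac)
  have "\<exists>t. 0 < t \<and> t < h \<and> frechet_derivative H (at ((z + of_real s * v) + of_real h * w)) v
       - frechet_derivative H (at ((z + of_real s * v) + of_real 0 * w)) v
    = (h - 0) * d2 H ((z + of_real s * v) + of_real t * w) v w"
  proof (rule MVT2)
    fix t assume t: "0 \<le> t" "t \<le> h"
    have "(z + of_real s * v) + of_real t * w \<in> U"
      using inU [OF _ _ t, of s] s sub by auto
    then show "((\<lambda>t. frechet_derivative H (at ((z + of_real s * v) + of_real t * w)) v) has_real_derivative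
        d2 H ((z + of_real s * v) + of_real t * w) v w) (at t)"
      unfolding d2_def
      by (intro has_real_derivative_along_curve [OF has_vector_derivative_translate]
          smooth_on_differentiable [OF smooth_on_frechet_derivative [OF H] U])
  qed (use h in auto)
  then obtain t where t: "0 < t" "t < h" and eq2:
    "frechet_derivative H (at ((z + of_real s * v) + of_real h * w)) v
       - frechet_derivative H (at ((z + of_real s * v) + of_real 0 * w)) v
    = h * d2 H ((z + of_real s * v) + of_real t * w) v w"
    by auto
  show ?thesis
    using eq1 unfolding eq2 using inU [of s t] s t by (intro bexI) auto
qed

text \<open>One second difference, read in both orders, equals both mixed derivatives at two points
  near \<open>z\<close>; continuity carries the equality to \<open>z\<close>.\<close>

lemma d2_commute:
  assumes U: "open U" and H: "smooth_on U H" and z: "z \<in> U"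
    and vw: "norm v = 1" "norm w = 1"
  shows "d2 H z v w = d2 H z w v"
proof (rule ccontr)
  assume ne: "d2 H z v w \<noteq> d2 H z w v"
  \<comment> \<open>Half the supposed gap: one number cannot be within \<open>e\<close> of both
    derivatives at \<open>z\<close>.\<close>
  define e where "e = \<bar>d2 H z v w - d2 H z w v\<bar> / 2"
  have "e > 0" using ne by (simp add: e_def)
  obtain R where R: "R > 0" "ball z R \<subseteq> U"
    using U z open_contains_ball by blast
  have "\<exists>d>0. \<forall>p\<in>U. dist p z < d \<longrightarrow> dist (d2 H p v w) (d2 H z v w) < e" for v w
    using continuous_on_d2 [OF H] z \<open>e > 0\<close> unfolding continuous_on_iff by blast
  then obtain d1 d2' where d: "d1 > 0" "\<And>p. p \<in> U \<Longrightarrow> dist p z < d1 \<Longrightarrow> dist (d2 H p v w) (d2 H z v w) < e"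
     "d2' > 0" "\<And>p. p \<in> U \<Longrightarrow> dist p z < d2' \<Longrightarrow> dist (d2 H p w v) (d2 H z w v) < e"
    by meson
  define h where "h = min R (min d1 d2') / 3"
  have h: "h > 0" "3 * h \<le> R" "3 * h \<le> d1" "3 * h \<le> d2'"
    using R d by (auto simp: h_def)
  have sub: "ball z (3 * h) \<subseteq> U"
    using R h by (meson subset_ball subset_trans)
  obtain p where p: "p \<in> ball z (3 * h)" "H (z + of_real h * v + of_real h * w) - H (z + of_real h * v)
      - (H (z + of_real h * w) - H z) = h * (h * d2 H p v w)"
    using d2_mean_value [OF U H h(1) vw sub] by blast
  obtain q where q: "q \<in> ball z (3 * h)" "H (z + of_real h * w + of_real h * v) - H (z + of_real h * w)
      - (H (z + of_real h * v) - H z) = h * (h * d2 H q w v)"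
    using d2_mean_value [OF U H h(1) vw(2,1) sub] by blast
  have "h * (h * d2 H p v w) = h * (h * d2 H q w v)"
    using p(2) q(2) unfolding add.assoc add.commute [of "of_real h * w" "of_real h * v"] by linarith
  then have "d2 H p v w = d2 H q w v"
    using h by simp
  moreover have "dist (d2 H p v w) (d2 H z v w) < e"
    using p(1) sub h by (intro d(2)) (auto simp: dist_commute)
  moreover have "dist (d2 H q w v) (d2 H z w v) < e"
    using q(1) sub h by (intro d(4)) (auto simp: dist_commute)
  ultimately show False
    by (simp add: e_def dist_real_def) (simp add: abs_if split: if_splits)
qed

section \<open>The moving frame along a level curve\<close>

lemma smooth_on_UNIV_has_vector_derivative:
  assumes "smooth_on UNIV g"
  shows "(g has_vector_derivative dcurve g t) (at t)"
  using smooth_on_differentiable [OF assms]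
  unfolding dcurve_def by (simp add: vector_derivative_works)

lemma smooth_on_dcurve:
  assumes "smooth_on UNIV g"
  shows "smooth_on UNIV (dcurve g)"
proof -
  have "dcurve g = (\<lambda>t. frechet_derivative g (at t) 1)"
    using smooth_on_differentiable [OF assms]
    by (auto simp: dcurve_def frechet_derivative_eq_vector_derivative)
  then show ?thesis
    using smooth_on_frechet_derivative [OF assms] by simp
qed

text \<open>In the frame \<open>T, n\<close> along the curve the Hessian of \<open>H\<close> has
  \<open>T\<close>-\<open>T\<close> entry \<open>- k H\<^sub>s\<close> and \<open>n\<close>-\<open>n\<close> entry \<open>H\<^sub>s\<^sub>s\<close>;
  rotating the frame by \<open>T\<close> multiplies \<open>conf_field\<close> by \<open>cnj T\<close> twice.\<close>
lemma conf_field_on_level_curve: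
  assumes U: "open U" "range g \<subseteq> U" and H: "smooth_on U H" and g: "smooth_on UNIV g"
    and arc: "\<And>t. norm (dcurve g t) = 1" and const: "\<And>t. H (g t) = c"
  shows "Re (conf_field H (g t) * cnj (dcurve g t ^ 2)) = H_ss H g t 0 + curvature g t * H_s H g t 0"
    and "(\<And>t. H_s H g t 0 = 0) \<Longrightarrow> conf_field H (g t) \<noteq> 0 \<Longrightarrow>
      Re (conf_field H (g t) * cnj (dcurve g t ^ 2)) \<noteq> 0"
proof -
  define T where "T = dcurve g"
  define D where "D u v = frechet_derivative H (at u) v" for u v
  have gT: "(g has_vector_derivative T t) (at t)" for t
    unfolding T_def by (rule smooth_on_UNIV_has_vector_derivative [OF g])
  have TT: "(T has_vector_derivative dcurve T t) (at t)" for t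
    unfolding T_def by (rule smooth_on_UNIV_has_vector_derivative [OF smooth_on_dcurve [OF g]])
  have Dlin: "D u v = Re v * D u 1 + Im v * D u \<i>" if "u \<in> U" for u v
    unfolding D_def
    using smooth_on_differentiable [OF H U(1) that] by (intro linear_complex_basis linear_frechet_derivative)
  have d2lin: "d2 H u v w = Re w * d2 H u v 1 + Im w * d2 H u v \<i>" if "u \<in> U" for u v w
    unfolding d2_def
    using smooth_on_differentiable [OF smooth_on_frechet_derivative [OF H] U(1) that]
    by (intro linear_complex_basis linear_frechet_derivative)
  have sym: "d2 H u \<i> 1 = d2 H u 1 \<i>" if "u \<in> U" for u
    using that by (intro d2_commute [OF U(1) H]) auto
  have dH: "((\<lambda>s. H (p s)) has_real_derivative D (p t) p') (at t)"
    if "(p has_vector_derivative p') (at t)" "p t \<in> U" for p p' t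
    unfolding D_def using that
    by (intro has_real_derivative_along_curve smooth_on_differentiable [OF H U(1)])
  have dD: "((\<lambda>s. D (p s) v) has_real_derivative d2 H (p t) v p') (at t)"
    if "(p has_vector_derivative p') (at t)" "p t \<in> U" for p p' t v
    unfolding D_def d2_def using that
    by (intro has_real_derivative_along_curve smooth_on_differentiable [OF smooth_on_frechet_derivative [OF H] U(1)])
  have gU: "g t \<in> U" for t using U(2) by auto
  define a b where "a t = Re (T t)" and "b t = Im (T t)" for t
  have ab: "a t * a t + b t * b t = 1" for t
    using arc [of t] cmod_power2 [of "T t"] by (simp add: T_def a_def b_def power2_eq_square)
  have DT: "D (g t) (T t) = 0" for t
  proof -
    have "((\<lambda>s. H (g s)) has_real_derivative D (g t) (T t)) (at t)"
      by (rule dH [OF gT gU])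
    moreover have "((\<lambda>s. H (g s)) has_real_derivative 0) (at t)"
      by (simp add: const)
    ultimately show ?thesis by (rule DERIV_unique)
  qed
  have DTab: "a t * D (g t) 1 + b t * D (g t) \<i> = 0" for t
    using DT [of t] Dlin [OF gU, of t "T t"] by (simp add: a_def b_def)
  have da: "(a has_real_derivative Re (dcurve T t)) (at t)"
    and db: "(b has_real_derivative Im (dcurve T t)) (at t)" for t
    unfolding a_def [abs_def] b_def [abs_def] has_real_derivative_iff_has_vector_derivative
    using bounded_linear.has_vector_derivative [OF bounded_linear_Re TT]
      bounded_linear.has_vector_derivative [OF bounded_linear_Im TT] by auto
  have ortho: "a t * Re (dcurve T t) + b t * Im (dcurve T t) = 0" for t
  proof -
    have "((\<lambda>t. a t * a t + b t * b t) has_real_derivative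
        (Re (dcurve T t) * a t + Re (dcurve T t) * a t) + (Im (dcurve T t) * b t + Im (dcurve T t) * b t)) (at t)"
      by (intro DERIV_add DERIV_mult da db)
    moreover have "((\<lambda>t. a t * a t + b t * b t) has_real_derivative 0) (at t)"
      by (simp add: ab)
    ultimately have "(Re (dcurve T t) * a t + Re (dcurve T t) * a t) + (Im (dcurve T t) * b t + Im (dcurve T t) * b t) = 0"
      by (rule DERIV_unique)
    then show ?thesis by (simp add: algebra_simps)
  qed
  define k where "k t = curvature g t" for t
  have k: "k t = a t * Im (dcurve T t) - b t * Re (dcurve T t)" for t
    by (simp add: k_def curvature_def T_def a_def b_def)
  \<comment> \<open>The Frenet equation \<open>dcurve T t = k t * \<i> * T t\<close> in coordinates,
    from the unit length of \<open>T\<close> and its orthogonality to the derivative.\<close>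
  have ReT2: "Re (dcurve T t) = - k t * b t" and ImT2: "Im (dcurve T t) = k t * a t" for t
    using ab [of t] ortho [of t] k [of t] by algebra+
  have Hs: "H_s H g t s = D (g t + of_real s * (\<i> * T t)) (\<i> * T t)"
    if "g t + of_real s * (\<i> * T t) \<in> U" for t s
    unfolding H_s_def Hts_def inward_normal_def T_def [symmetric]
    by (rule DERIV_imp_deriv, rule dH [OF has_vector_derivative_translate that])
  have Hs0: "H_s H g t 0 = - b t * D (g t) 1 + a t * D (g t) \<i>" for t
    using Hs [of t 0] gU [of t] Dlin [OF gU, of t "\<i> * T t"] by (simp add: a_def b_def)
  let ?xx = "\<lambda>t. d2 H (g t) 1 1" and ?xy = "\<lambda>t. d2 H (g t) 1 \<i>" and ?yy = "\<lambda>t. d2 H (g t) \<i> \<i>"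
  have Hss: "H_ss H g t 0 = b t * b t * ?xx t - 2 * a t * b t * ?xy t + a t * a t * ?yy t" for t
  proof -
    let ?p = "\<lambda>s. g t + of_real s * (\<i> * T t)"
    let ?f = "\<lambda>s. - b t * D (?p s) 1 + a t * D (?p s) \<i>"
    have p0: "?p 0 \<in> U" using gU [of t] by simp
    \<comment> \<open>\<open>H_ss\<close> differentiates \<open>H_s\<close> in \<open>s\<close>, so
      the formula for \<open>H_s\<close> is needed near \<open>s = 0\<close> and not only at 0;
      openness of \<open>U\<close> provides this.\<close>
    have "isCont ?p 0"
      by (intro continuous_intros)
    then have "\<forall>\<^sub>F s in nhds 0. ?p s \<in> U"
      using U(1) p0 by (metis eventually_nhds_x_imp_x isCont_def filterlim_def topological_tendstoD tendsto_at_iff_tendsto_nhds)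
    then have "\<forall>\<^sub>F s in nhds 0. H_s H g t s = ?f s"
    proof eventually_elim
      case (elim s)
      then show ?case
        using Hs [OF elim] Dlin [OF elim, of "\<i> * T t"] by (simp add: a_def b_def)
    qed
    then have deriv: "H_ss H g t 0 = deriv ?f 0"
      unfolding H_ss_def by (intro deriv_cong_ev) auto
    have e: "d2 H (g t) 1 (\<i> * T t) = - b t * ?xx t + a t * ?xy t"
      "d2 H (g t) \<i> (\<i> * T t) = - b t * ?xy t + a t * ?yy t"
      using d2lin [OF gU, of t 1 "\<i> * T t"] d2lin [OF gU, of t \<i> "\<i> * T t"] sym [OF gU, of t]
      by (simp_all add: a_def b_def)
    note deriv
    also have "deriv ?f 0 = - b t * d2 H (?p 0) 1 (\<i> * T t) + a t * d2 H (?p 0) \<i> (\<i> * T t)"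
      by (intro DERIV_imp_deriv DERIV_add DERIV_cmult dD [OF has_vector_derivative_translate p0])
    also have "\<dots> = b t * b t * ?xx t - 2 * a t * b t * ?xy t + a t * a t * ?yy t"
      by (simp add: e algebra_simps)
    finally show ?thesis .
  qed
  \<comment> \<open>Differentiating the vanishing tangential derivative \<open>DTab\<close> along
    the curve gives the tangential Hessian entry plus the derivative of \<open>H\<close> in
    direction \<open>dcurve T t\<close>, which is \<open>k t * H_s H g t 0\<close>.\<close>
  have Htt: "a t * a t * ?xx t + 2 * a t * b t * ?xy t + b t * b t * ?yy t = - k t * H_s H g t 0" for t
  proof -
    have e: "d2 H (g t) 1 (T t) = a t * ?xx t + b t * ?xy t"
      "d2 H (g t) \<i> (T t) = a t * ?xy t + b t * ?yy t"
      using d2lin [OF gU, of t 1 "T t"] d2lin [OF gU, of t \<i> "T t"] sym [OF gU, of t]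
      by (simp_all add: a_def b_def)
    have "((\<lambda>t. a t * D (g t) 1 + b t * D (g t) \<i>) has_real_derivative
      (Re (dcurve T t) * D (g t) 1 + d2 H (g t) 1 (T t) * a t) +
      (Im (dcurve T t) * D (g t) \<i> + d2 H (g t) \<i> (T t) * b t)) (at t)"
      by (intro DERIV_add DERIV_mult da db dD gT gU)
    moreover have "((\<lambda>t. a t * D (g t) 1 + b t * D (g t) \<i>) has_real_derivative 0) (at t)"
      by (simp add: DTab)
    ultimately have "(Re (dcurve T t) * D (g t) 1 + d2 H (g t) 1 (T t) * a t) +
      (Im (dcurve T t) * D (g t) \<i> + d2 H (g t) \<i> (T t) * b t) = 0"
      by (rule DERIV_unique)
    then show ?thesis
      unfolding ReT2 ImT2 Hs0 e by (simp add: algebra_simps)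
  qed
  \<comment> \<open>The right side is the normal Hessian entry of \<open>Hss\<close> minus the
    tangential entry of \<open>Htt\<close>.\<close>
  have frame: "Re (conf_field H (g t) * cnj (dcurve g t ^ 2))
      = (a t * a t - b t * b t) * (?yy t - ?xx t) - 4 * a t * b t * ?xy t" for t
    by (simp add: conf_field_def Hxx_def Hyy_def Hxy_def T_def [symmetric] a_def b_def power2_eq_square algebra_simps)
  have main: "Re (conf_field H (g t) * cnj (dcurve g t ^ 2)) = H_ss H g t 0 + k t * H_s H g t 0" for t
    using Hss [of t] Htt [of t] unfolding frame by (simp add: algebra_simps)
  then show "Re (conf_field H (g t) * cnj (dcurve g t ^ 2)) = H_ss H g t 0 + curvature g t * H_s H g t 0"
    by (simp add: k_def)
  \<comment> \<open>If \<open>H_s\<close> vanishes, the whole gradient vanishes along the curve, and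
    differentiating it there puts \<open>T\<close> into the kernel of the Hessian. Were the normal
    entry \<open>H_ss\<close> zero as well, the Hessian and with it \<open>conf_field\<close> would
    vanish.\<close>
  show "Re (conf_field H (g t) * cnj (dcurve g t ^ 2)) \<noteq> 0"
    if s0: "\<And>t. H_s H g t 0 = 0" and nz: "conf_field H (g t) \<noteq> 0"
  proof
    assume "Re (conf_field H (g t) * cnj (dcurve g t ^ 2)) = 0"
    then have "H_ss H g t 0 = 0" using main [of t] s0 [of t] by simp
    have "D (g t) 1 = 0 \<and> D (g t) \<i> = 0" for t
    proof -
      have "a t * D (g t) 1 + b t * D (g t) \<i> = 0"
        by (rule DTab)
      moreover have "- b t * D (g t) 1 + a t * D (g t) \<i> = 0"
        using s0 [of t] Hs0 [of t] by simp
      ultimately show ?thesis using ab [of t] by algebra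
    qed
    then have D0: "(\<lambda>t. D (g t) 1) = (\<lambda>t. 0)" "(\<lambda>t. D (g t) \<i>) = (\<lambda>t. 0)"
      by auto
    have "((\<lambda>s. D (g s) 1) has_real_derivative d2 H (g t) 1 (T t)) (at t)"
      "((\<lambda>s. D (g s) \<i>) has_real_derivative d2 H (g t) \<i> (T t)) (at t)"
      by (rule dD [OF gT gU])+
    then have "d2 H (g t) 1 (T t) = 0" "d2 H (g t) \<i> (T t) = 0"
      unfolding D0 by (auto intro: DERIV_unique [OF _ DERIV_const])
    then have "a t * ?xx t + b t * ?xy t = 0" "a t * ?xy t + b t * ?yy t = 0"
      using d2lin [OF gU, of t 1 "T t"] d2lin [OF gU, of t \<i> "T t"] sym [OF gU, of t]
      by (simp_all add: a_def b_def)
    then have "?xx t = 0 \<and> ?xy t = 0 \<and> ?yy t = 0"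
      using \<open>H_ss H g t 0 = 0\<close> Hss [of t] ab [of t] by algebra
    then show False
      using nz by (simp add: conf_field_def Hxx_def Hyy_def Hxy_def complex_eq_iff)
  qed
qed

section \<open>Total index\<close>

lemma winding_number_Re_nonzero:
  assumes p: "path p" "pathfinish p = pathstart p" and Re: "\<And>t. t \<in> {0..1} \<Longrightarrow> Re (p t) \<noteq> 0"
  shows "winding_number p 0 = 0"
proof -
  have nz: "p t \<noteq> 0" if "t \<in> {0..1}" for t
    using Re [OF that] by auto
  \<comment> \<open>Squaring treats both signs of the real part at once: \<open>p t ^ 2\<close>
    avoids the branch cut, so the closed path \<open>p ^ 2\<close>, which winds twice as often as
    \<open>p\<close>, does not wind.\<close>
  have "p t ^ 2 \<notin> \<real>\<^sub>\<le>\<^sub>0" if "t \<in> {0..1}" for t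
  proof
    assume "p t ^ 2 \<in> \<real>\<^sub>\<le>\<^sub>0"
    then have "Re (p t) * Re (p t) \<le> Im (p t) * Im (p t)" "Im (p t) = 0"
      using Re [OF that] by (auto simp: complex_nonpos_Reals_iff power2_eq_square)
    then show False
      using Re [OF that] by (auto simp: mult_le_0_iff)
  qed
  then have "continuous_on {0..1} (\<lambda>t. Ln (p t ^ 2))"
    using p(1) by (intro continuous_intros) (auto simp: path_def)
  then have "winding_number (\<lambda>t. p t powi 2) 0 = (Ln (p 1 ^ 2) - Ln (p 0 ^ 2)) / (2 * of_real pi * \<i>)"
    using nz by (intro winding_number_log_increment) auto
  moreover have "0 \<notin> path_image p"
    using nz by (auto simp: path_image_def)
  ultimately show ?thesis
    using winding_number_power_int [of p 2] p by (simp add: pathfinish_def pathstart_def)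
qed

lemma compact_isolated_finite:
  fixes S :: "'a::metric_space set"
  assumes "compact S" "\<And>z. z \<in> S \<Longrightarrow> \<exists>e>0. \<forall>w\<in>S. 0 < dist w z \<longrightarrow> e \<le> dist w z"
  shows "finite S"
proof (rule ccontr)
  assume "infinite S"
  then obtain z where z: "z \<in> S" "z islimpt S"
    using assms(1) unfolding compact_eq_Bolzano_Weierstrass by blast
  obtain e where "e > 0" "\<And>w. w \<in> S \<Longrightarrow> 0 < dist w z \<Longrightarrow> e \<le> dist w z"
    using assms(2) [OF z(1)] by blast
  then show False
    using z(2) unfolding islimpt_approachable by (metis not_less zero_less_dist_iff)
qed

theorem theorem1:
  fixes g :: "real \<Rightarrow> complex" and L :: real and H :: "complex \<Rightarrow> real"
    and D U :: "complex set" and c :: real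
  assumes L_pos: "L > 0"
    and g_smooth: "smooth_on UNIV g"
    and g_periodic: "\<forall>t. g (t + L) = g t"
    and g_simple: "inj_on g {0..<L}"
    and g_arclength: "\<forall>t. norm (dcurve g t) = 1"
    and D_def: "D = path_image (\<lambda>u. g (L * u)) \<union> inside (path_image (\<lambda>u. g (L * u)))"
    and g_orient: "\<forall>z \<in> inside (path_image (\<lambda>u. g (L * u))). winding_number (\<lambda>u. g (L * u)) z = 1"
    and U_open: "open U" and D_sub: "D \<subseteq> U"
    and H_smooth: "smooth_on U H"
    and H_const: "\<forall>t. H (g t) = c"
    and isolated: "\<forall>z \<in> D. conf_field H z = 0 \<longrightarrow>
                     (\<exists>e>0. \<forall>w. 0 < dist w z \<and> dist w z < e \<longrightarrow> conf_field H w \<noteq> 0)"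
    and not_on_boundary: "\<forall>t. conf_field H (g t) \<noteq> 0"
    and cond: "(\<forall>t. H_ss H g t 0 + curvature g t * H_s H g t 0 \<noteq> 0) \<or> (\<forall>t. H_s H g t 0 = 0)"
  shows "finite {z \<in> interior D. conf_field H z = 0} \<and>
         (\<Sum>z \<in> {z \<in> interior D. conf_field H z = 0}. zero_index (conf_field H) z) = 2"
proof -
  define c' where "c' = (\<lambda>u. g (L * u))"
  define T where "T = dcurve g"
  define V where "V = conf_field H"
  have gT: "(g has_vector_derivative T t) (at t)" for t
    unfolding T_def by (rule smooth_on_UNIV_has_vector_derivative [OF g_smooth])
  have contg: "continuous_on UNIV g" and contT: "continuous_on UNIV T"
    unfolding T_def by (intro smooth_on_imp_continuous_on smooth_on_dcurve g_smooth)+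
  have path: "path c'"
    unfolding path_def c'_def
    by (rule continuous_on_compose2 [OF contg]) (auto intro!: continuous_intros)
  have loop: "pathfinish c' = pathstart c'"
    using g_periodic [rule_format, of 0] by (simp add: c'_def pathfinish_def pathstart_def)
  have "loop_free c'"
    unfolding loop_free_def
  proof (intro ballI impI)
    fix x y :: real assume xy: "x \<in> {0..1}" "y \<in> {0..1}" "c' x = c' y"
    \<comment> \<open>Moves the parameter 1 to 0, so that injectivity on the half-open period
      applies.\<close>
    define r where "r u = (if u = 1 then 0 else u)" for u :: real
    have r: "c' (r u) = c' u" "L * r u \<in> {0..<L}" if "u \<in> {0..1}" for u
      using that loop L_pos by (auto simp: r_def pathfinish_def pathstart_def)
    have "L * r x = L * r y"
      using g_simple r xy unfolding c'_def by (metis inj_onD)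
    then show "x = y \<or> x = 0 \<and> y = 1 \<or> x = 1 \<and> y = 0"
      using L_pos by (auto simp: r_def split: if_splits)
  qed
  then have simple: "simple_path c'"
    using path by (simp add: simple_path_def)
  have image: "path_image c' = range g"
  proof
    show "path_image c' \<subseteq> range g" by (auto simp: path_image_def c'_def)
    show "range g \<subseteq> path_image c'"
    proof
      fix x assume "x \<in> range g"
      then obtain t where "x = g t" by blast
      then obtain s where "s \<in> {0..<L}" "x = g s"
        using periodic_in_range [of L g t] L_pos g_periodic by metis
      then show "x \<in> path_image c'"
        using L_pos unfolding path_image_def c'_def by (intro image_eqI [of _ _ "s / L"]) auto
    qed
  qed
  have Jordan: "inside (path_image c') \<noteq> {}" "open (inside (path_image c'))"
      "bounded (inside (path_image c'))" "connected (outside (path_image c'))"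
    using Jordan_inside_outside [OF simple loop] by auto
  have D: "D = path_image c' \<union> inside (path_image c')"
    using D_def by (simp add: c'_def)
  have "closed D"
    unfolding D by (rule closed_path_image_Un_inside [OF path])
  moreover have "bounded D"
    unfolding D using Jordan path by (simp add: bounded_path_image)
  ultimately have compD: "compact D"
    by (simp add: compact_eq_bounded_closed)
  have connD: "connected (- D)"
    unfolding D union_with_inside using Jordan by simp
  have intD: "inside (path_image c') \<subseteq> interior D"
    using Jordan D by (intro interior_maximal) auto
  have contV: "continuous_on D V"
    unfolding V_def by (rule continuous_on_subset [OF continuous_on_conf_field [OF H_smooth] D_sub])
  define Z where "Z = {z \<in> interior D. V z = 0}"
  have Vg: "V (g t) \<noteq> 0" for t
    using not_on_boundary by (simp add: V_def)
  \<comment> \<open>With no zeros on the curve, the zeros in the interior are all zeros in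
    \<open>D\<close>; this form shows that \<open>Z\<close> is compact.\<close>
  have Z: "Z = {z \<in> D. V z = 0}"
    using intD D image Vg interior_subset [of D] by (auto simp: Z_def)
  have Zin: "z \<in> inside (path_image c')" if "z \<in> Z" for z
    using that D image Vg unfolding Z by auto
  have finZ: "finite Z"
  proof (rule compact_isolated_finite)
    have "closed (D \<inter> V -` {0})"
      using contV compD by (intro continuous_closed_preimage) (auto simp: compact_imp_closed)
    moreover have "Z = D \<inter> (D \<inter> V -` {0})"
      unfolding Z by auto
    ultimately show "compact Z"
      using compD by (metis compact_Int_closed)
    show "\<exists>e>0. \<forall>w\<in>Z. 0 < dist w z \<longrightarrow> e \<le> dist w z" if "z \<in> Z" for z
      using isolated that unfolding Z V_def by (metis (mono_tags, lifting) mem_Collect_eq not_less)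
  qed
  \<comment> \<open>The orientation gives winding number 1 about every inside point, so any of them
    can be the reference point for the turning number.\<close>
  obtain z where z: "z \<in> inside (path_image c')"
    using Jordan(1) by blast
  have T0: "T t \<noteq> 0" for t
    using g_arclength by (metis T_def norm_zero zero_neq_one)
  have turn: "winding_number (\<lambda>u. T (L * u)) 0 = 1"
  proof (rule turning_number_simple_closed_curve [OF L_pos gT contT])
    show "z \<notin> range g"
      using z image inside_no_overlap by blast
    show "winding_number (\<lambda>u. g (L * u)) z = 1"
      using g_orient z by (simp add: c'_def)
  qed (use g_periodic g_simple T0 in auto)
  have contVg: "continuous_on UNIV (\<lambda>t. V (g t))"
    using image D by (intro continuous_on_compose2 [OF contV contg]) auto
  \<comment> \<open>Multiplying by \<open>cnj (T t ^ 2)\<close> refers the field to the moving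
    frame; as \<open>T\<close> has norm 1, multiplying by \<open>T t ^ 2\<close> recovers
    \<open>V\<close>.\<close>
  define q where "q t = V (g t) * cnj (T t ^ 2)" for t
  have contq: "continuous_on UNIV q"
    unfolding q_def by (intro continuous_intros contVg contT)
  have "range g \<subseteq> U" using image D D_sub by blast
  note level = conf_field_on_level_curve [OF U_open this H_smooth g_smooth, of c, OF g_arclength [rule_format] H_const [rule_format]]
  have Req: "Re (q t) \<noteq> 0" for t
    using cond
  proof
    assume "\<forall>t. H_ss H g t 0 + curvature g t * H_s H g t 0 \<noteq> 0"
    then show ?thesis
      using level(1) [of t] by (simp add: q_def V_def T_def del: times_complex.sel)
  next
    assume "\<forall>t. H_s H g t 0 = 0"
    then show ?thesis
      using level(2) [of t] not_on_boundary by (simp add: q_def V_def T_def del: times_complex.sel)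
  qed
  have q0: "q t \<noteq> 0" for t
    using Req [of t] by auto
  have scale: "path (\<lambda>u. f (L * u))" if "continuous_on UNIV f" for f :: "real \<Rightarrow> complex"
    unfolding path_def by (rule continuous_on_compose2 [OF that]) (auto intro!: continuous_intros)
  have TL: "T L = T 0"
    using has_vector_derivative_periodic [OF gT g_periodic [rule_format], of 0] by simp
  have wq: "winding_number (\<lambda>u. q (L * u)) 0 = 0"
    using Req TL g_periodic [rule_format, of 0]
    by (intro winding_number_Re_nonzero scale contq) (auto simp: q_def pathfinish_def pathstart_def)
  have factor: "V \<circ> c' = (\<lambda>u. T (L * u) powi 2 * q (L * u))"
  proof
    fix u
    have "T t ^ 2 * cnj (T t ^ 2) = 1" for t
      using g_arclength by (simp add: complex_norm_square [symmetric] T_def norm_power flip: complex_cnj_power)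
    then show "(V \<circ> c') u = T (L * u) powi 2 * q (L * u)"
      by (simp add: c'_def q_def mult.left_commute)
  qed
  have "winding_number (V \<circ> c') 0
      = winding_number (\<lambda>u. T (L * u) powi 2) 0 + winding_number (\<lambda>u. q (L * u)) 0"
    unfolding factor using T0 q0 contT contq
    by (intro winding_number_mult scale) (force simp: path_image_def intro!: continuous_intros)+
  also have "winding_number (\<lambda>u. T (L * u) powi 2) 0 = 2"
  proof -
    have "0 \<notin> path_image (\<lambda>u. T (L * u))"
      using T0 by (force simp: path_image_def)
    then show ?thesis
      using winding_number_power_int [OF scale [OF contT], of 2] turn by simp
  qed
  finally have "winding_number (V \<circ> c') 0 = 2"
    unfolding wq add_0_right .
  moreover have "winding_number (V \<circ> c') 0 = (\<Sum>p\<in>Z. winding_number c' p * zero_index V p)"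
  proof (rule winding_number_zero_index_sum [OF compD connD contV _ finZ _ path loop])
    show "path_image c' \<subseteq> D - Z"
      using D image Vg by (auto simp: Z)
    show "Z \<subseteq> interior D"
      by (auto simp: Z_def)
    show "V z \<noteq> 0" if "z \<in> D - Z" for z
      using that by (auto simp: Z)
  qed
  \<comment> \<open>All zeros lie inside the curve, so every weight in the index sum is 1.\<close>
  moreover have "winding_number c' p = 1" if "p \<in> Z" for p
    using g_orient Zin [OF that] by (simp add: c'_def)
  ultimately have "(\<Sum>p\<in>Z. zero_index V p) = 2"
    by (simp del: o_apply comp_apply)
  then show ?thesis
    using finZ by (simp add: Z_def V_def)
qed

end
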